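(* Let $a<b$ be real numbers and let $\mathcal I$ be a set of subintervals of $[a,b]$. Suppose that $\mathcal I$ satisfies the following two conditions: (O) for all $r,s,t\in[a,b]$ with $r<s\le t$: if $[a,s]\in\mathcal I$ and $[r,t]\in\mathcal I$, then $[a,t]\in\mathcal I$; (B) for every $s\in[a,b]$ there exists $\delta>0$ such that the interval $[a,b]\cap[s-\delta,s+\delta]$ belongs to $\mathcal I$. Then $[a,b]\in\mathcal I$.
   Context: Intervals are intervals of the real line $\mathbb R$. *)

theory Defs
  imports "HOL-Analysis.Analysis"
begin

end

theory Submission
  imports Defs
begin

text \<open>A supremum argument, as in proofs of compactness of a closed interval. Let
  \<open>c\<close> be the supremum of all \<open>s\<close> with \<open>{a..s}\<close> in
  \<open>\<I>\<close>. Condition \<open>B\<close> at \<open>c\<close> gives a member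
  \<open>{r..t}\<close> of \<open>\<I>\<close> around \<open>c\<close>. Some such \<open>s\<close>
  lies beyond \<open>r\<close>, so \<open>O\<close> glues the two intervals into
  \<open>{a..t}\<close>. If \<open>c\<close> were less than \<open>b\<close>, then \<open>t\<close>
  would exceed \<open>c\<close>, which is impossible; hence \<open>t = b\<close>.\<close>

theorem mainTheorem2:
  fixes a b :: real and \<I> :: "real set set"
  assumes "a < b"
    and subintervals: "\<And>J. J \<in> \<I> \<Longrightarrow> is_interval J \<and> J \<subseteq> {a..b}"
    and O: "\<And>r s t. r \<in> {a..b} \<Longrightarrow> s \<in> {a..b} \<Longrightarrow> t \<in> {a..b} \<Longrightarrow> r < s \<Longrightarrow> s \<le> t \<Longrightarrow>
      {a..s} \<in> \<I> \<Longrightarrow> {r..t} \<in> \<I> \<Longrightarrow> {a..t} \<in> \<I>"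
    and B: "\<And>s. s \<in> {a..b} \<Longrightarrow> \<exists>\<delta>>0. {a..b} \<inter> {s - \<delta>..s + \<delta>} \<in> \<I>"
  shows "{a..b} \<in> \<I>"
proof -
  define S where "S = {s \<in> {a..b}. {a..s} \<in> \<I>}"
  define c where "c = Sup S"
  have bdd: "bdd_above S"
    unfolding S_def by (rule bdd_aboveI[of _ b]) auto
  obtain d where d: "d > 0" "{a..b} \<inter> {a - d..a + d} \<in> \<I>"
    using B[of a] \<open>a < b\<close> by auto
  have "{a..b} \<inter> {a - d..a + d} = {a..min b (a + d)}"
    using d(1) by auto
  with d \<open>a < b\<close> have start: "min b (a + d) \<in> S"
    unfolding S_def by simp
  \<comment> \<open>Strictness of \<open>a < c\<close> matters: the interval around \<open>c\<close>
    is cut off at \<open>a\<close>, so \<open>c = a\<close> would give \<open>r = c\<close> and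
    leave no \<open>s\<close> in \<open>S\<close> beyond \<open>r\<close>.\<close>
  then have "min b (a + d) \<le> c"
    unfolding c_def using bdd by (rule cSup_upper)
  with d(1) \<open>a < b\<close> have "a < c"
    by linarith
  have "c \<le> b"
    unfolding c_def
  proof (rule cSup_least)
    show "S \<noteq> {}"
      using start by blast
  qed (simp add: S_def)
  obtain e where e: "e > 0" "{a..b} \<inter> {c - e..c + e} \<in> \<I>"
    using B[of c] \<open>a < c\<close> \<open>c \<le> b\<close> by auto
  define r t where "r = max a (c - e)" and "t = min b (c + e)"
  have rt: "{r..t} \<in> \<I>"
    using e(2) by (simp add: r_def t_def Int_atLeastAtMost)
  have bounds: "a \<le> r" "r < c" "c \<le> t" "t \<le> b"
    using e(1) \<open>a < c\<close> \<open>c \<le> b\<close> by (auto simp: r_def t_def)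
  obtain s where s: "s \<in> S" "r < s"
    using \<open>r < c\<close> start less_cSupE[of r S] by (auto simp: c_def)
  have "s \<le> c"
    unfolding c_def using s(1) bdd by (rule cSup_upper)
  \<comment> \<open>The overlap that \<open>O\<close> demands is
    \<open>r < s \<le> c \<le> t\<close>.\<close>
  with s bounds rt have "t \<in> S"
    using O[of r s t] by (auto simp: S_def)
  then have "t \<le> c"
    unfolding c_def using bdd by (rule cSup_upper)
  \<comment> \<open>Since \<open>t \<le> c < c + e\<close>, the minimum defining \<open>t\<close>
    must be attained at \<open>b\<close>.\<close>
  with e(1) have "t = b"
    by (auto simp: t_def min_def split: if_splits)
  with \<open>t \<in> S\<close> show ?thesis
    by (simp add: S_def)
qed

end
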